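(* Let $(a_n),(b_n),(a_n'),(b_n')$ be sequences of positive integers, and put $c_n=\frac{a_n}{b_n}$, $c_n'=\frac{a_n'}{b_n'}$. Assume that $b_n\mid b_{n+1}$ and $b_n'\mid b_{n+1}'$ for all $n\ge1$, that $\lim_{n\to\infty}a_n\frac{c_{n+1}}{c_n}=0$ and $\lim_{n\to\infty}a_n'\frac{c_{n+1}'}{c_n'}=0$ (so that $\alpha=\sum_{n=1}^\infty c_n$ and $\beta=\sum_{n=1}^\infty c_n'$ are convergent), and moreover that $$\lim_{n\to\infty}\frac{a_{n+1}b_n b_n'}{b_{n+1}}=0\quad\text{and}\quad \lim_{n\to\infty}\frac{a_{n+1}' b_n' b_n}{b_{n+1}'}=0 .$$ Then $\alpha+\beta$ is an irrational number. *)

theory Defs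
  imports Complex_Main
begin

end

theory Submission
  imports Defs
begin

text \<open>
  The ratio conditions make both series converge so fast that each tail is eventually at most twice
  its first term. If \<open>\<alpha> + \<beta>\<close> had denominator \<open>q\<close>, then \<open>q b\<^sub>n b'\<^sub>n\<close> times the difference of
  \<open>\<alpha> + \<beta>\<close> and its \<open>n\<close>-th partial sum would be a positive integer; the last two limit
  conditions force it to tend to \<open>0\<close>.
\<close>

text \<open>From some index on, each term is at most half of its predecessor. The tail from
  \<open>n\<close> is then dominated by the geometric series \<open>f n * (1/2) ^ k\<close>, whose
  sum \<open>2 * f n\<close> accounts for the factor 2.\<close>

lemma summable_tail_le_twice_head:
  fixes f :: "nat \<Rightarrow> real"
  assumes pos: "\<And>n. f n > 0"
    and lim: "(\<lambda>n. f (Suc n) / f n) \<longlonglongrightarrow> 0"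
  shows "summable f" and "\<forall>\<^sub>F n in sequentially. (\<Sum>k. f (k + n)) \<le> 2 * f n"
proof -
  have "\<forall>\<^sub>F n in sequentially. f (Suc n) / f n < 1/2"
    using lim by (rule order_tendstoD) simp
  then obtain N where N: "\<And>n. n \<ge> N \<Longrightarrow> f (Suc n) / f n < 1/2"
    by (auto simp: eventually_sequentially)
  have half: "f (Suc n) \<le> f n * (1/2)" if "n \<ge> N" for n
    using N[OF that] pos[of n] by (simp add: field_simps)
  have geo: "f (k + n) \<le> f n * (1/2) ^ k" if "n \<ge> N" for n k
  proof (induction k)
    case (Suc k)
    then show ?case using half[of "k + n"] that by simp
  qed simp
  have geo_sums: "(\<lambda>k. f n * (1/2) ^ k) sums (2 * f n)" for n
    using sums_mult[OF geometric_sums[of "1/2 :: real"], of "f n"] by (simp add: mult.commute)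
  have tail: "summable (\<lambda>k. f (k + n))" if "n \<ge> N" for n
    by (rule summable_comparison_test'[OF sums_summable[OF geo_sums], of 0])
       (use geo[OF that] pos in \<open>auto simp: less_imp_le\<close>)
  then show "summable f"
    using summable_iff_shift[of f N] by blast
  have "(\<Sum>k. f (k + n)) \<le> 2 * f n" if "n \<ge> N" for n
    using suminf_le[OF geo[OF that] tail[OF that] sums_summable[OF geo_sums]]
      sums_unique[OF geo_sums[of n]] by simp
  then show "\<forall>\<^sub>F n in sequentially. (\<Sum>k. f (k + n)) \<le> 2 * f n"
    by (auto simp: eventually_sequentially)
qed

text \<open>Serves to strip the numerators \<open>a n\<close> and \<open>a' n\<close> from the ratio
  hypotheses: positive integers are at least 1, so \<open>r n\<close> is squeezed between 0 and
  \<open>w n * r n\<close>.\<close>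

lemma tendsto_zero_of_weighted:
  fixes w r :: "nat \<Rightarrow> real"
  assumes "(\<lambda>n. w n * r n) \<longlonglongrightarrow> 0" and w: "\<And>n. w n \<ge> 1" and r: "\<And>n. r n \<ge> 0"
  shows "r \<longlonglongrightarrow> 0"
proof (rule tendsto_sandwich[OF _ _ tendsto_const assms(1)])
  show "\<forall>\<^sub>F n in sequentially. r n \<le> w n * r n"
    using mult_right_mono[OF w r] by simp
qed (simp add: r)

lemma denominator_mult_partial_sum_Ints:
  fixes a b :: "nat \<Rightarrow> nat"
  assumes pos: "\<And>n. b n > 0" and dvd: "\<And>n. b n dvd b (Suc n)"
  shows "real (b n) * (\<Sum>k\<le>n. real (a k) / real (b k)) \<in> \<int>"
proof -
  have "real (b n) * (real (a k) / real (b k)) \<in> \<int>" if "k \<le> n" for k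
  proof -
    have "b k dvd b n"
      using that by (induction rule: dec_induct) (auto intro: dvd dvd_trans)
    then obtain m where "b n = b k * m" ..
    then have "real (b n) * (real (a k) / real (b k)) = of_int (int (m * a k))"
      using pos[of k] by simp
    then show ?thesis by (simp only: Ints_of_int)
  qed
  then show ?thesis
    unfolding sum_distrib_left by (intro Ints_sum) auto
qed

text \<open>If \<open>x\<close> had denominator \<open>q\<close>, then
  \<open>q * d n * (x - s n)\<close> would be an integer for every \<open>n\<close> while tending to
  0. The strict inequality \<open>s n < x\<close> rules out the value 0, so a value below 1 is
  already contradictory.\<close>

lemma irrational_if_approximable:
  fixes x :: real and s :: "nat \<Rightarrow> real" and d :: "nat \<Rightarrow> nat"
  assumes d_pos: "\<And>n. d n > 0"
    and int: "\<And>n. real (d n) * s n \<in> \<int>"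
    and less: "\<And>n. s n < x"
    and lim: "(\<lambda>n. real (d n) * (x - s n)) \<longlonglongrightarrow> 0"
  shows "x \<notin> \<rat>"
proof
  assume "x \<in> \<rat>"
  then obtain p q :: int where q: "q > 0" and x: "x = of_int p / of_int q"
    by (rule Rats_cases')
  have "(\<lambda>n. of_int q * (real (d n) * (x - s n))) \<longlonglongrightarrow> 0"
    using tendsto_mult_right_zero[OF lim] by simp
  then have "\<forall>\<^sub>F n in sequentially. of_int q * (real (d n) * (x - s n)) < 1"
    by (rule order_tendstoD) simp
  then obtain n where small: "of_int q * (real (d n) * (x - s n)) < 1"
    using eventually_happens'[OF sequentially_bot] by blast
  \<comment> \<open>Here \<open>q\<close> clears the denominator of \<open>x\<close> and
    \<open>d n\<close> that of \<open>s n\<close>.\<close>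
  have "of_int q * (real (d n) * (x - s n)) = of_int (p * int (d n)) - of_int q * (real (d n) * s n)"
    using q by (simp add: x field_simps)
  also have "\<dots> \<in> \<int>"
    by (intro Ints_diff Ints_mult int Ints_of_int)
  finally obtain z :: int where z: "of_int q * (real (d n) * (x - s n)) = of_int z"
    by (rule Ints_cases)
  have "of_int q * (real (d n) * (x - s n)) > 0"
    using q d_pos less by simp
  with small show False unfolding z by simp
qed

theorem theorem3:
  fixes a b a' b' :: "nat \<Rightarrow> nat" and c c' :: "nat \<Rightarrow> real"
  assumes a_pos: "\<And>n. n \<ge> 1 \<Longrightarrow> a n > 0"
    and b_pos: "\<And>n. n \<ge> 1 \<Longrightarrow> b n > 0"
    and a'_pos: "\<And>n. n \<ge> 1 \<Longrightarrow> a' n > 0"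
    and b'_pos: "\<And>n. n \<ge> 1 \<Longrightarrow> b' n > 0"
    and c_eq: "\<And>n. n \<ge> 1 \<Longrightarrow> c n = real (a n) / real (b n)"
    and c'_eq: "\<And>n. n \<ge> 1 \<Longrightarrow> c' n = real (a' n) / real (b' n)"
    and b_dvd: "\<And>n. n \<ge> 1 \<Longrightarrow> b n dvd b (n + 1)"
    and b'_dvd: "\<And>n. n \<ge> 1 \<Longrightarrow> b' n dvd b' (n + 1)"
    and lim_c: "(\<lambda>n. real (a n) * (c (n + 1) / c n)) \<longlonglongrightarrow> 0"
    and lim_c': "(\<lambda>n. real (a' n) * (c' (n + 1) / c' n)) \<longlonglongrightarrow> 0"
    and lim_b: "(\<lambda>n. real (a (n + 1)) * real (b n) * real (b' n) / real (b (n + 1))) \<longlonglongrightarrow> 0"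
    and lim_b': "(\<lambda>n. real (a' (n + 1)) * real (b' n) * real (b n) / real (b' (n + 1))) \<longlonglongrightarrow> 0"
  shows "summable (\<lambda>n. c (n + 1)) \<and> summable (\<lambda>n. c' (n + 1)) \<and>
    (\<Sum>n. c (n + 1)) + (\<Sum>n. c' (n + 1)) \<notin> \<rat>"
proof -
  \<comment> \<open>Positivity, divisibility and the quotient formulas are given only from index 1
    on, whereas the lemmas ask for all indices. Hence every sequence is used in the shifted form
    \<open>n + 1\<close>.\<close>
  have c_pos: "c (n + 1) > 0" for n
    using a_pos b_pos by (simp add: c_eq)
  have c'_pos: "c' (n + 1) > 0" for n
    using a'_pos b'_pos by (simp add: c'_eq)
  have "(\<lambda>n. c (Suc n + 1) / c (n + 1)) \<longlonglongrightarrow> 0"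
  proof (rule tendsto_zero_of_weighted)
    show "(\<lambda>n. real (a (n + 1)) * (c (Suc n + 1) / c (n + 1))) \<longlonglongrightarrow> 0"
      using LIMSEQ_ignore_initial_segment[OF lim_c, of 1] by simp
    show "real (a (n + 1)) \<ge> 1" for n
      using a_pos[of "n + 1"] by simp
    show "c (Suc n + 1) / c (n + 1) \<ge> 0" for n
      using c_pos[of n] c_pos[of "Suc n"] by simp
  qed
  note c = summable_tail_le_twice_head[of "\<lambda>n. c (n + 1)", OF c_pos this]
  have "(\<lambda>n. c' (Suc n + 1) / c' (n + 1)) \<longlonglongrightarrow> 0"
  proof (rule tendsto_zero_of_weighted)
    show "(\<lambda>n. real (a' (n + 1)) * (c' (Suc n + 1) / c' (n + 1))) \<longlonglongrightarrow> 0"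
      using LIMSEQ_ignore_initial_segment[OF lim_c', of 1] by simp
    show "real (a' (n + 1)) \<ge> 1" for n
      using a'_pos[of "n + 1"] by simp
    show "c' (Suc n + 1) / c' (n + 1) \<ge> 0" for n
      using c'_pos[of n] c'_pos[of "Suc n"] by simp
  qed
  note c' = summable_tail_le_twice_head[of "\<lambda>n. c' (n + 1)", OF c'_pos this]

  define x where "x = (\<Sum>n. c (n + 1)) + (\<Sum>n. c' (n + 1))"
  \<comment> \<open>The sums in \<open>s n\<close> run over the original indices 1 to
    \<open>n + 1\<close>. So \<open>d n\<close> takes its factors at \<open>n + 1\<close>, and the
    remainders start at \<open>n + 2\<close>, which makes them \<open>t (Suc n)\<close> and
    \<open>t' (Suc n)\<close>.\<close>
  define s where "s n = (\<Sum>k\<le>n. c (k + 1)) + (\<Sum>k\<le>n. c' (k + 1))" for n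
  define d where "d n = b (n + 1) * b' (n + 1)" for n
  define t where "t n = (\<Sum>k. c (k + n + 1))" for n
  define t' where "t' n = (\<Sum>k. c' (k + n + 1))" for n
  have diff: "x - s n = t (Suc n) + t' (Suc n)" for n
    using suminf_split_initial_segment[OF c(1), of "Suc n"]
      suminf_split_initial_segment[OF c'(1), of "Suc n"]
    by (simp add: x_def s_def t_def t'_def lessThan_Suc_atMost)
  have t_pos: "t n > 0" for n
    unfolding t_def using c_pos[of "_ + n"] summable_ignore_initial_segment[OF c(1), of n]
    by (intro suminf_pos) auto
  have t'_pos: "t' n > 0" for n
    unfolding t'_def using c'_pos[of "_ + n"] summable_ignore_initial_segment[OF c'(1), of n]
    by (intro suminf_pos) auto
  \<comment> \<open>The sequences of the last two limit hypotheses: \<open>e (Suc n)\<close> is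
    \<open>d n\<close> times the first omitted term \<open>c (n + 2)\<close>, and
    \<open>e' (Suc n)\<close> is \<open>d n\<close> times \<open>c' (n + 2)\<close>.\<close>
  define e where "e n = real (a (n + 1)) * real (b n) * real (b' n) / real (b (n + 1))" for n
  define e' where "e' n = real (a' (n + 1)) * real (b' n) * real (b n) / real (b' (n + 1))" for n

  have "x \<notin> \<rat>"
  proof (rule irrational_if_approximable[of d s])
    show "d n > 0" for n
      using b_pos b'_pos by (simp add: d_def)
    show "s n < x" for n
      using diff[of n] t_pos[of "Suc n"] t'_pos[of "Suc n"] by linarith
    show "real (d n) * s n \<in> \<int>" for n
    proof -
      have "real (b (n + 1)) * (\<Sum>k\<le>n. c (k + 1)) \<in> \<int>"
        using denominator_mult_partial_sum_Ints[of "\<lambda>n. b (n + 1)" n "\<lambda>n. a (n + 1)"] b_pos b_dvd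
        by (simp add: c_eq)
      moreover have "real (b' (n + 1)) * (\<Sum>k\<le>n. c' (k + 1)) \<in> \<int>"
        using denominator_mult_partial_sum_Ints[of "\<lambda>n. b' (n + 1)" n "\<lambda>n. a' (n + 1)"] b'_pos b'_dvd
        by (simp add: c'_eq)
      \<comment> \<open>Each factor of \<open>d n\<close> clears its own partial sum; the other
        factor only multiplies the resulting integer.\<close>
      moreover have "real (d n) * s n =
          real (b' (n + 1)) * (real (b (n + 1)) * (\<Sum>k\<le>n. c (k + 1))) +
          real (b (n + 1)) * (real (b' (n + 1)) * (\<Sum>k\<le>n. c' (k + 1)))"
        by (simp add: d_def s_def algebra_simps)
      ultimately show ?thesis
        by (metis Ints_add Ints_mult Ints_of_nat)
    qed
    have lim: "(\<lambda>n. 2 * (e (Suc n) + e' (Suc n))) \<longlonglongrightarrow> 0"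
      using tendsto_mult_right_zero[OF tendsto_add_zero[OF LIMSEQ_Suc[OF lim_b] LIMSEQ_Suc[OF lim_b']], of 2]
      by (simp add: e_def e'_def)
    show "(\<lambda>n. real (d n) * (x - s n)) \<longlonglongrightarrow> 0"
    proof (rule tendsto_sandwich[OF _ _ tendsto_const lim])
      \<comment> \<open>The tail estimates hold from some index on, hence also at
        \<open>Suc n\<close>; \<open>le_SucI\<close> makes this shift.\<close>
      have "\<forall>\<^sub>F n in sequentially. t (Suc n) \<le> 2 * c (Suc n + 1)"
        "\<forall>\<^sub>F n in sequentially. t' (Suc n) \<le> 2 * c' (Suc n + 1)"
        using c(2) c'(2) unfolding t_def t'_def
        by (auto simp only: eventually_sequentially intro: le_SucI)
      then show "\<forall>\<^sub>F n in sequentially. real (d n) * (x - s n) \<le> 2 * (e (Suc n) + e' (Suc n))"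
      proof eventually_elim
        case (elim n)
        have "real (d n) * (x - s n) = real (d n) * (t (Suc n) + t' (Suc n))"
          by (simp add: diff)
        also have "\<dots> \<le> real (d n) * (2 * c (Suc n + 1) + 2 * c' (Suc n + 1))"
          using elim by (intro mult_left_mono add_mono) auto
        also have "\<dots> = 2 * (e (Suc n) + e' (Suc n))"
          by (simp add: d_def e_def e'_def c_eq c'_eq algebra_simps)
        finally show ?case .
      qed
    qed (simp add: diff t_pos t'_pos less_imp_le add_pos_pos)
  qed
  with c(1) c'(1) show ?thesis unfolding x_def by blast
qed

end
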